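(* Let $\mathcal{L}:\mathbb{R}^{d_x}\times\mathbb{R}^{d_y}\to\mathbb{R}$ be differentiable, let $\mathcal{X}\subset\mathbb{R}^{d_x}$ and $\mathcal{Y}\subset\mathbb{R}^{d_y}$ be closed sets, let $(x_0,y_0)\in\mathcal{X}\times\mathcal{Y}$, $\rho_x,\rho_y>0$, $\mathcal{X}_0=\mathcal{X}\cap\mathbb{B}_2(x_0,\rho_x)$, $\mathcal{Y}_0=\mathcal{Y}\cap\mathbb{B}_2(y_0,\rho_y)$, and let $(\widehat{x},\widehat{y})=\arg\min\{\mathcal{L}(x,y):x\in\mathcal{X}_0,y\in\mathcal{Y}_0\}$. Suppose that there are constants $0<\alpha_x\le\beta_x$, $0<\alpha_y\le\beta_y$, $0\le\mu_x\le\alpha_x$, $0\le\mu_y\le\alpha_y$, $\epsilon_x,\epsilon_y\ge0$ such that the following five assumptions (stated in full in the context) hold: joint restricted strong convexity, restricted smoothness, the cross-product bound, the initialization condition, and the relaxed triangle inequality. Let $(x_t,y_t)_{t\ge1}$ be any sequence generated by the inexact alternating minimization algorithm with tolerances $\delta_t^x,\delta_t^y\ge0$: for all $t\ge1$, $$x_t^{\mathrm{exact}}=\arg\min_{x\in\mathcal{X}_0}\mathcal{L}(x,y_{t-1}),\quad x_t\in\mathcal{X}_0\cap\mathbb{B}_2(x_t^{\mathrm{exact}},\delta_t^x),$$ $$y_t^{\mathrm{exact}}=\arg\min_{y\in\mathcal{Y}_0}\mathcal{L}(x_t,y),\quad y_t\in\mathcal{Y}_0\cap\mathbb{B}_2(y_t^{\mathrm{exact}},\delta_t^y).$$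 Then for all $t\ge1$, $$D(x_t;\widehat{x})\le\sqrt{1-\frac{\alpha_y}{2\beta_y}}\cdot D(y_{t-1};\widehat{y})+\sqrt{\beta_x}\,\delta_t^x+\sqrt{8(\alpha_x\epsilon_x^2+\alpha_y\epsilon_y^2)},$$ $$D(y_t;\widehat{y})\le\sqrt{1-\frac{\alpha_x}{2\beta_x}}\cdot D(x_t;\widehat{x})+\sqrt{\beta_y}\,\delta_t^y+\sqrt{8(\alpha_x\epsilon_x^2+\alpha_y\epsilon_y^2)}.$$
   Context: **Notation.** $\mathbb{B}_2(z,\rho)$ is the closed Euclidean ball of center $z$ and radius $\rho$. All argmins are assumed to exist; if an argmin is not unique, it denotes a chosen minimizer (the same choice in the algorithm and in the initialization condition). $\|\cdot\|_x$ and $\|\cdot\|_y$ are fixed norms on $\mathbb{R}^{d_x}$ and $\mathbb{R}^{d_y}$ satisfying $\|\cdot\|_x\ge\|\cdot\|_2$, $\|\cdot\|_y\ge\|\cdot\|_2$; $\|\cdot\|_x^*$, $\|\cdot\|_y^*$ are their dual norms. **Local concavity coefficients.** Let $\mathcal{Z}\subset\mathbb{R}^d$ be closed and $\|\cdot\|$ a norm on $\mathbb{R}^d$. $\mathcal{Z}$ satisfies the curvature condition at $z\in\mathcal{Z}$ with parameter $\gamma_z\in[0,\infty]$ if for all $z'\in\mathcal{Z}$, $\limsup_{t\to0^+}\frac{\min_{w\in\mathcal{Z}}\|w-((1-t)z+tz')\|}{t}\le\gamma_z\|z-z'\|_2^2$. A point $z\in\mathcal{Z}$ is degenerate if the Euclidean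 projection $\mathcal{P}_{\mathcal{Z}}$ onto $\mathcal{Z}$ is not continuous in any neighborhood of $z$. The local concavity coefficient $\gamma_z(\mathcal{Z})$ is $\infty$ if $z$ is degenerate, and otherwise the smallest $\gamma_z\in[0,\infty]$ such that the curvature condition holds at $z$. The global coefficient is $\gamma(\mathcal{Z})=\sup_{z\in\mathcal{Z}}\gamma_z(\mathcal{Z})$. Here $\gamma(\mathcal{X}_0)$ is taken with respect to $\|\cdot\|_x$ and $\gamma(\mathcal{Y}_0)$ with respect to $\|\cdot\|_y$. **First-order divergence.** $D^2(x;\widehat{x})=\langle x-\widehat{x},\nabla_x\mathcal{L}(x,\widehat{y})-\nabla_x\mathcal{L}(\widehat{x},\widehat{y})\rangle$ and $D^2(y;\widehat{y})=\langle y-\widehat{y},\nabla_y\mathcal{L}(\widehat{x},y)-\nabla_y\mathcal{L}(\widehat{x},\widehat{y})\rangle$ (these may be negative); $D(x;\widehat{x})=\sqrt{\max\{0,D^2(x;\widehat{x})\}}$, $D(y;\widehat{y})=\sqrt{\max\{0,D^2(y;\widehat{y})\}}$. **Joint restricted strong convexity.** For all $x\in\mathcal{X}_0$, $y\in\mathcal{Y}_0$: $\left\langle\begin{pmatrix}x-\widehat{x}\\ y-\widehat{y}\end{pmatrix},\nabla\mathcal{L}(x,y)-\nabla\mathcal{L}(\widehat{x},\widehat{y})\right\rangle\ge\alpha_x\|x-\widehat{x}\|_2^2+\alpha_y\|y-\widehat{y}\|_2^2-\alpha_x\epsilon_x^2-\alpha_y\epsilon_y^2$. **Restricted smoothness.**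 For all $x\in\mathcal{X}_0$, $y\in\mathcal{Y}_0$: $D^2(x;\widehat{x})\le\beta_x\|x-\widehat{x}\|_2^2+\alpha_x\epsilon_x^2$ and $D^2(y;\widehat{y})\le\beta_y\|y-\widehat{y}\|_2^2+\alpha_y\epsilon_y^2$. **Cross-product bound.** For all $x\in\mathcal{X}_0$, $y\in\mathcal{Y}_0$: $\left|\langle x-\widehat{x},\nabla_x\mathcal{L}(x,y)-\nabla_x\mathcal{L}(x,\widehat{y})\rangle-\langle y-\widehat{y},\nabla_y\mathcal{L}(x,y)-\nabla_y\mathcal{L}(\widehat{x},y)\rangle\right|\le\frac12\mu_x\|x-\widehat{x}\|_2^2+\frac12\mu_y\|y-\widehat{y}\|_2^2+\alpha_x\epsilon_x^2+\alpha_y\epsilon_y^2$. **Initialization condition.** With $x_y=\arg\min\{\mathcal{L}(x,y):x\in\mathcal{X}_0\}$ for $y\in\mathcal{Y}_0$ and $y_x=\arg\min\{\mathcal{L}(x,y):y\in\mathcal{Y}_0\}$ for $x\in\mathcal{X}_0$: $2\gamma(\mathcal{X}_0)\left(\|\nabla_x\mathcal{L}(\widehat{x},\widehat{y})\|_x^*+\max_{y\in\mathcal{Y}_0}\|\nabla_x\mathcal{L}(x_y,y)\|_x^*\right)\le\alpha_x-\mu_x$ and $2\gamma(\mathcal{Y}_0)\left(\|\nabla_y\mathcal{L}(\widehat{x},\widehat{y})\|_y^*+\max_{x\in\mathcal{X}_0}\|\nabla_y\mathcal{L}(x,y_x)\|_y^*\right)\le\alpha_y-\mu_y$. **Relaxed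 triangle inequality.** For all $x,x'\in\mathcal{X}_0$: $D(x;\widehat{x})\le D(x';\widehat{x})+\sqrt{\beta_x}\|x-x'\|_2+\sqrt{\alpha_x}\,\epsilon_x$; and for all $y,y'\in\mathcal{Y}_0$: $D(y;\widehat{y})\le D(y';\widehat{y})+\sqrt{\beta_y}\|y-y'\|_2+\sqrt{\alpha_y}\,\epsilon_y$. *)

theory Defs
  imports "HOL-Analysis.Analysis"
begin

definition gradient :: "('a::real_inner \<Rightarrow> real) \<Rightarrow> 'a \<Rightarrow> 'a" where
  "gradient f x = (THE g. GDERIV f x :> g)"

lemma gradient_eqI:
  assumes "GDERIV f x :> g"
  shows "gradient f x = g"
  unfolding gradient_def
proof (rule the_equality[where P = "\<lambda>g. GDERIV f x :> g", OF assms])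
  fix h assume "GDERIV f x :> h"
  with assms have "(\<lambda>v. inner v h) = (\<lambda>v. inner v g)"
    unfolding gderiv_def by (rule has_derivative_unique[rotated])
  then show "h = g"
    by (metis inner_eq_zero_iff inner_diff_right right_minus_eq)
qed

definition grad_x :: "('a::euclidean_space \<times> 'b::euclidean_space \<Rightarrow> real) \<Rightarrow> 'a \<Rightarrow> 'b \<Rightarrow> 'a" where
  "grad_x L x y = gradient (\<lambda>u. L (u, y)) x"

definition grad_y :: "('a::euclidean_space \<times> 'b::euclidean_space \<Rightarrow> real) \<Rightarrow> 'a \<Rightarrow> 'b \<Rightarrow> 'b" where
  "grad_y L x y = gradient (\<lambda>v. L (x, v)) y"

definition is_norm :: "('a::real_vector \<Rightarrow> real) \<Rightarrow> bool" where
  "is_norm N \<longleftrightarrow>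
     (\<forall>x. 0 \<le> N x) \<and> (\<forall>x. N x = 0 \<longleftrightarrow> x = 0) \<and>
     (\<forall>c x. N (c *\<^sub>R x) = \<bar>c\<bar> * N x) \<and> (\<forall>x y. N (x + y) \<le> N x + N y)"

definition dual_norm :: "('a::euclidean_space \<Rightarrow> real) \<Rightarrow> 'a \<Rightarrow> real" where
  "dual_norm N v = (SUP u\<in>{u. N u \<le> 1}. v \<bullet> u)"

definition curvature_condition ::
  "('a::euclidean_space \<Rightarrow> real) \<Rightarrow> 'a set \<Rightarrow> 'a \<Rightarrow> ennreal \<Rightarrow> bool" where
  "curvature_condition N Z z \<gamma> \<longleftrightarrow>
     (\<forall>z'\<in>Z. Limsup (at_right 0)
        (\<lambda>t::real. ennreal ((INF w\<in>Z. N (w - ((1 - t) *\<^sub>R z + t *\<^sub>R z'))) / t))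
        \<le> \<gamma> * ennreal ((norm (z - z'))\<^sup>2))"

text \<open>
  \<open>closest_point\<close> picks one of the nearest points when there are several. Degeneracy does not
  depend on the choice: if \<open>u\<close> has two nearest points \<open>p\<close> and \<open>q\<close>, then the points of the
  half-open segment from \<open>u\<close> (excluded) to \<open>p\<close> have \<open>p\<close> as their only nearest point, and
  likewise for \<open>q\<close>, so every selection is discontinuous at \<open>u\<close>.
\<close>

definition degenerate_point :: "'a::euclidean_space set \<Rightarrow> 'a \<Rightarrow> bool" where
  "degenerate_point Z z \<longleftrightarrow>
     \<not> (\<exists>U. open U \<and> z \<in> U \<and> continuous_on U (closest_point Z))"

definition local_concavity :: "('a::euclidean_space \<Rightarrow> real) \<Rightarrow> 'a set \<Rightarrow> 'a \<Rightarrow> ennreal" where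
  "local_concavity N Z z =
     (if degenerate_point Z z then \<infinity> else Inf {\<gamma>. curvature_condition N Z z \<gamma>})"

definition concavity :: "('a::euclidean_space \<Rightarrow> real) \<Rightarrow> 'a set \<Rightarrow> ennreal" where
  "concavity N Z = (SUP z\<in>Z. local_concavity N Z z)"

definition div2_x ::
  "('a::euclidean_space \<times> 'b::euclidean_space \<Rightarrow> real) \<Rightarrow> 'a \<Rightarrow> 'b \<Rightarrow> 'a \<Rightarrow> real" where
  "div2_x L xh yh x = (x - xh) \<bullet> (grad_x L x yh - grad_x L xh yh)"

definition div2_y ::
  "('a::euclidean_space \<times> 'b::euclidean_space \<Rightarrow> real) \<Rightarrow> 'a \<Rightarrow> 'b \<Rightarrow> 'b \<Rightarrow> real" where
  "div2_y L xh yh y = (y - yh) \<bullet> (grad_y L xh y - grad_y L xh yh)"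

definition div_x ::
  "('a::euclidean_space \<times> 'b::euclidean_space \<Rightarrow> real) \<Rightarrow> 'a \<Rightarrow> 'b \<Rightarrow> 'a \<Rightarrow> real" where
  "div_x L xh yh x = sqrt (max 0 (div2_x L xh yh x))"

definition div_y ::
  "('a::euclidean_space \<times> 'b::euclidean_space \<Rightarrow> real) \<Rightarrow> 'a \<Rightarrow> 'b \<Rightarrow> 'b \<Rightarrow> real" where
  "div_y L xh yh y = sqrt (max 0 (div2_y L xh yh y))"

definition joint_RSC ::
  "('a::euclidean_space \<times> 'b::euclidean_space \<Rightarrow> real) \<Rightarrow> 'a set \<Rightarrow> 'b set \<Rightarrow> 'a \<Rightarrow> 'b \<Rightarrow>
   real \<Rightarrow> real \<Rightarrow> real \<Rightarrow> real \<Rightarrow> bool" where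
  "joint_RSC L X0 Y0 xh yh \<alpha>x \<alpha>y \<epsilon>x \<epsilon>y \<longleftrightarrow>
     (\<forall>x\<in>X0. \<forall>y\<in>Y0.
        (x - xh, y - yh) \<bullet> (gradient L (x, y) - gradient L (xh, yh))
        \<ge> \<alpha>x * (norm (x - xh))\<^sup>2 + \<alpha>y * (norm (y - yh))\<^sup>2 - \<alpha>x * \<epsilon>x\<^sup>2 - \<alpha>y * \<epsilon>y\<^sup>2)"

definition restricted_smoothness ::
  "('a::euclidean_space \<times> 'b::euclidean_space \<Rightarrow> real) \<Rightarrow> 'a set \<Rightarrow> 'b set \<Rightarrow> 'a \<Rightarrow> 'b \<Rightarrow>
   real \<Rightarrow> real \<Rightarrow> real \<Rightarrow> real \<Rightarrow> real \<Rightarrow> real \<Rightarrow> bool" where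
  "restricted_smoothness L X0 Y0 xh yh \<alpha>x \<alpha>y \<beta>x \<beta>y \<epsilon>x \<epsilon>y \<longleftrightarrow>
     (\<forall>x\<in>X0. \<forall>y\<in>Y0.
        div2_x L xh yh x \<le> \<beta>x * (norm (x - xh))\<^sup>2 + \<alpha>x * \<epsilon>x\<^sup>2 \<and>
        div2_y L xh yh y \<le> \<beta>y * (norm (y - yh))\<^sup>2 + \<alpha>y * \<epsilon>y\<^sup>2)"

definition cross_product_bound ::
  "('a::euclidean_space \<times> 'b::euclidean_space \<Rightarrow> real) \<Rightarrow> 'a set \<Rightarrow> 'b set \<Rightarrow> 'a \<Rightarrow> 'b \<Rightarrow>
   real \<Rightarrow> real \<Rightarrow> real \<Rightarrow> real \<Rightarrow> real \<Rightarrow> real \<Rightarrow> bool" where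
  "cross_product_bound L X0 Y0 xh yh \<alpha>x \<alpha>y \<mu>x \<mu>y \<epsilon>x \<epsilon>y \<longleftrightarrow>
     (\<forall>x\<in>X0. \<forall>y\<in>Y0.
        \<bar>(x - xh) \<bullet> (grad_x L x y - grad_x L x yh) - (y - yh) \<bullet> (grad_y L x y - grad_y L xh y)\<bar>
        \<le> 1/2 * \<mu>x * (norm (x - xh))\<^sup>2 + 1/2 * \<mu>y * (norm (y - yh))\<^sup>2
           + \<alpha>x * \<epsilon>x\<^sup>2 + \<alpha>y * \<epsilon>y\<^sup>2)"

text \<open>
  The functions \<open>xmin\<close> and \<open>ymin\<close> are the chosen minimizers \<open>y \<mapsto> x_y\<close> and \<open>x \<mapsto> y_x\<close>. The
  maxima of the gradient norms are suprema in \<open>[0, \<infinity>]\<close>, and \<open>\<infinity> * 0 = 0\<close> in \<^typ>\<open>ennreal\<close>.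
\<close>

definition initialization_condition ::
  "('a::euclidean_space \<times> 'b::euclidean_space \<Rightarrow> real) \<Rightarrow> ('a \<Rightarrow> real) \<Rightarrow> ('b \<Rightarrow> real) \<Rightarrow>
   'a set \<Rightarrow> 'b set \<Rightarrow> 'a \<Rightarrow> 'b \<Rightarrow> ('b \<Rightarrow> 'a) \<Rightarrow> ('a \<Rightarrow> 'b) \<Rightarrow>
   real \<Rightarrow> real \<Rightarrow> real \<Rightarrow> real \<Rightarrow> bool" where
  "initialization_condition L Nx Ny X0 Y0 xh yh xmin ymin \<alpha>x \<alpha>y \<mu>x \<mu>y \<longleftrightarrow>
     2 * concavity Nx X0 *
       (ennreal (dual_norm Nx (grad_x L xh yh))
        + (SUP y\<in>Y0. ennreal (dual_norm Nx (grad_x L (xmin y) y)))) \<le> ennreal (\<alpha>x - \<mu>x) \<and>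
     2 * concavity Ny Y0 *
       (ennreal (dual_norm Ny (grad_y L xh yh))
        + (SUP x\<in>X0. ennreal (dual_norm Ny (grad_y L x (ymin x))))) \<le> ennreal (\<alpha>y - \<mu>y)"

definition relaxed_triangle ::
  "('a::euclidean_space \<times> 'b::euclidean_space \<Rightarrow> real) \<Rightarrow> 'a set \<Rightarrow> 'b set \<Rightarrow> 'a \<Rightarrow> 'b \<Rightarrow>
   real \<Rightarrow> real \<Rightarrow> real \<Rightarrow> real \<Rightarrow> real \<Rightarrow> real \<Rightarrow> bool" where
  "relaxed_triangle L X0 Y0 xh yh \<alpha>x \<alpha>y \<beta>x \<beta>y \<epsilon>x \<epsilon>y \<longleftrightarrow>
     (\<forall>x\<in>X0. \<forall>x'\<in>X0.
        div_x L xh yh x \<le> div_x L xh yh x' + sqrt \<beta>x * norm (x - x') + sqrt \<alpha>x * \<epsilon>x) \<and>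
     (\<forall>y\<in>Y0. \<forall>y'\<in>Y0.
        div_y L xh yh y \<le> div_y L xh yh y' + sqrt \<beta>y * norm (y - y') + sqrt \<alpha>y * \<epsilon>y)"

end

theory Submission
  imports Defs
begin

text \<open>
  Moving from a minimizer \<open>z\<close> of \<open>f\<close> over \<open>Z\<close> towards \<open>z' \<in> Z\<close> and correcting back onto \<open>Z\<close>
  costs at most \<open>\<gamma> \<parallel>z' - z\<parallel>\<^sup>2\<close> to first order, so
  \<open>\<langle>z' - z, \<nabla>f z\<rangle> \<ge> - \<gamma> \<parallel>\<nabla>f z\<parallel>\<^sup>* \<parallel>z' - z\<parallel>\<^sup>2\<close>. Applied at \<open>xh\<close> and at the exact
  minimizer \<open>u\<close> for \<open>v\<close>, together with the initialization condition, this gives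
  \<open>\<langle>u - xh, \<nabla>\<^sub>x L(u, v) - \<nabla>\<^sub>x L(xh, yh)\<rangle> \<le> (\<alpha>x - \<mu>x) / 2 \<parallel>u - xh\<parallel>\<^sup>2\<close>. Inserting it into
  restricted strong convexity, trading the cross term of \<open>y\<close> for that of \<open>x\<close>, and using
  smoothness in \<open>y\<close>, one finds
  \<open>D\<^sup>2(u) \<le> (1 - \<alpha>y / (2 \<beta>y)) D\<^sup>2(v) + 5/2 (\<alpha>x \<epsilon>x\<^sup>2 + \<alpha>y \<epsilon>y\<^sup>2)\<close>. The relaxed triangle
  inequality passes from \<open>u\<close> to the inexact iterate, and \<open>sqrt (5/2) + 1 \<le> sqrt 8\<close>.
\<close>

section \<open>Dual norms of norms dominating the Euclidean one\<close>

text \<open>Domination puts the unit ball of \<open>N\<close> inside the Euclidean one. The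
  real-valued \<open>SUP\<close> in \<open>dual_norm\<close> is thus a genuine supremum.\<close>

lemma bdd_above_dual_norm:
  fixes N :: "'a::euclidean_space \<Rightarrow> real"
  assumes "\<forall>v. norm v \<le> N v"
  shows "bdd_above ((\<lambda>u. g \<bullet> u) ` {u. N u \<le> 1})"
proof (rule bdd_aboveI2)
  fix u assume "u \<in> {u. N u \<le> 1}"
  then have "norm u \<le> 1" using assms order_trans by blast
  then show "g \<bullet> u \<le> norm g"
    by (metis norm_cauchy_schwarz mult_left_le norm_ge_zero order_trans)
qed

lemma dual_norm_nonneg:
  fixes N :: "'a::euclidean_space \<Rightarrow> real"
  assumes N: "is_norm N" and le: "\<forall>v. norm v \<le> N v"
  shows "0 \<le> dual_norm N g"
proof -
  have "N 0 = 0" using N by (simp add: is_norm_def)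
  then have "g \<bullet> 0 \<le> dual_norm N g"
    unfolding dual_norm_def by (intro cSUP_upper bdd_above_dual_norm[OF le]) auto
  then show ?thesis by simp
qed

lemma inner_le_dual_norm:
  fixes N :: "'a::euclidean_space \<Rightarrow> real"
  assumes N: "is_norm N" and le: "\<forall>v. norm v \<le> N v"
  shows "g \<bullet> u \<le> dual_norm N g * N u"
proof (cases "u = 0")
  case True
  then have "N u = 0" using N unfolding is_norm_def by blast
  then show ?thesis using True by simp
next
  case False
  then have pos: "0 < N u" using N by (metis is_norm_def order_le_less)
  have "N (inverse (N u) *\<^sub>R u) = \<bar>inverse (N u)\<bar> * N u"
    using N by (simp add: is_norm_def)
  then have "N (inverse (N u) *\<^sub>R u) \<le> 1" using pos by simp
  then have "g \<bullet> (inverse (N u) *\<^sub>R u) \<le> dual_norm N g"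
    unfolding dual_norm_def by (intro cSUP_upper bdd_above_dual_norm[OF le]) auto
  then show ?thesis using pos by (simp add: field_simps)
qed

lemma dual_norm_eq_0:
  fixes N :: "'a::euclidean_space \<Rightarrow> real"
  assumes "is_norm N" and "\<forall>v. norm v \<le> N v" and "dual_norm N g = 0"
  shows "g = 0"
  using inner_le_dual_norm[OF assms(1,2), of g g] assms(3)
  by (metis inner_eq_zero_iff inner_ge_zero mult_zero_left order_antisym)

section \<open>First-order optimality over non-convex sets\<close>

lemma minimizer_variational_inequality:
  fixes f :: "'a::euclidean_space \<Rightarrow> real"
  assumes N: "is_norm N" and le: "\<forall>v. norm v \<le> N v"
    and min: "is_arg_min f (\<lambda>u. u \<in> Z) z" and z': "z' \<in> Z"
    and g: "GDERIV f z :> g"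
    and k: "concavity N Z = ennreal k" "0 \<le> k"
  shows "- (k * dual_norm N g * (norm (z' - z))\<^sup>2) \<le> (z' - z) \<bullet> g"
proof (cases "z' = z")
  case False
  define n where "n = (norm (z - z'))\<^sup>2"
  have n: "0 < n" using False by (simp add: n_def)
  have zZ: "z \<in> Z" using min by (simp add: is_arg_min_def)
  have fmin: "f z \<le> f w" if "w \<in> Z" for w
    using min that by (meson is_arg_min_def not_le)
  define d where "d = dual_norm N g"
  have d: "0 \<le> d" unfolding d_def by (rule dual_norm_nonneg[OF N le])
  \<comment> \<open>Two slacks: \<open>c\<close> exceeds \<open>k * n\<close> strictly because an
    infimum of curvature parameters is only approached, and \<open>e\<close> is the relative error
    of the first-order expansion of \<open>f\<close>.\<close>
  have lower: "- (c * d) - e * (norm (z' - z) + c) \<le> (z' - z) \<bullet> g"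
    if ck: "k * n < c" and e: "0 < e" for c e :: real
  proof -
    have "local_concavity N Z z \<le> ennreal k"
      using zZ k unfolding concavity_def by (metis SUP_upper)
    also have "\<dots> < ennreal (c / n)"
    proof (rule ennreal_lessI)
      show "k < c / n" using ck n by (simp add: pos_less_divide_eq)
      then show "0 < c / n" using k by linarith
    qed
    finally have lc: "local_concavity N Z z < ennreal (c / n)" .
    \<comment> \<open>A finite coefficient rules out degeneracy of \<open>z\<close>, which leaves
      the infimum branch.\<close>
    then have "Inf {\<gamma>. curvature_condition N Z z \<gamma>} < ennreal (c / n)"
      by (auto simp: local_concavity_def split: if_splits)
    then obtain \<gamma> where \<gamma>: "curvature_condition N Z z \<gamma>" "\<gamma> < ennreal (c / n)"
      by (auto simp: Inf_less_iff)
    have c: "0 < c" using ck k n by (meson le_less_trans less_eq_real_def mult_nonneg_nonneg)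
    have "Limsup (at_right 0)
        (\<lambda>t::real. ennreal ((INF w\<in>Z. N (w - ((1 - t) *\<^sub>R z + t *\<^sub>R z'))) / t)) \<le> \<gamma> * ennreal n"
      using \<gamma>(1) z' by (simp add: curvature_condition_def n_def)
    also have "\<dots> < ennreal (c / n) * ennreal n"
      using \<gamma>(2) n by (intro ennreal_mult_strict_right_mono) auto
    also have "\<dots> = ennreal c" using n c by (simp flip: ennreal_mult)
    finally have ev1: "\<forall>\<^sub>F t in at_right (0::real).
        ennreal ((INF w\<in>Z. N (w - ((1 - t) *\<^sub>R z + t *\<^sub>R z'))) / t) < ennreal c"
      by (rule Limsup_lessD)
    have "(f has_derivative (\<lambda>h. h \<bullet> g)) (at z)" using g by (simp add: gderiv_def)
    then obtain r where r: "0 < r"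
      and der: "\<And>w. norm (w - z) < r \<Longrightarrow> \<bar>f w - f z - (w - z) \<bullet> g\<bar> \<le> e * norm (w - z)"
      unfolding has_derivative_at_alt using e by (metis real_norm_def)
    \<comment> \<open>A corrected point \<open>w\<close> will satisfy
      \<open>norm (w - z) \<le> t * M\<close>: the segment contributes \<open>norm (z' - z)\<close>,
      the correction at most \<open>c\<close>. So \<open>t < r / M\<close> keeps \<open>w\<close>
      where the expansion is valid.\<close>
    define M where "M = norm (z' - z) + c"
    have M: "0 < M" using c by (simp add: M_def add_nonneg_pos)
    have ev2: "\<forall>\<^sub>F t in at_right (0::real). t \<in> {0<..<r / M}"
      using r M by (intro eventually_at_right_real) simp
    obtain t where t: "0 < t" "t < r / M"
      and inf: "ennreal ((INF w\<in>Z. N (w - ((1 - t) *\<^sub>R z + t *\<^sub>R z'))) / t) < ennreal c"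
      using eventually_happens[OF eventually_conj[OF ev1 ev2]]
      by (auto simp: trivial_limit_at_right_real)
    define p where "p = (1 - t) *\<^sub>R z + t *\<^sub>R z'"
    have "(INF w\<in>Z. N (w - p)) / t < c"
      using inf c ennreal_leI leI p_def not_less by blast
    then have "(INF w\<in>Z. N (w - p)) < c * t" using t by (simp add: pos_divide_less_eq)
    moreover have "bdd_below ((\<lambda>w. N (w - p)) ` Z)"
      using N by (intro bdd_belowI2[where m = 0]) (simp add: is_norm_def)
    ultimately obtain w where w: "w \<in> Z" "N (w - p) < c * t"
      using zZ cINF_less_iff[of Z "\<lambda>w. N (w - p)"] by blast
    have split: "w - z = (w - p) + t *\<^sub>R (z' - z)"
      by (simp add: p_def algebra_simps)
    have "norm (w - z) \<le> norm (w - p) + t * norm (z' - z)"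
      unfolding split using t by (metis norm_triangle_ineq norm_scaleR abs_of_pos)
    also have "\<dots> \<le> t * M"
      using w(2) le[rule_format, of "w - p"] by (simp add: M_def algebra_simps)
    finally have wz: "norm (w - z) \<le> t * M" .
    also have "\<dots> < r" using t M by (simp add: pos_less_divide_eq)
    finally have "\<bar>f w - f z - (w - z) \<bullet> g\<bar> \<le> e * norm (w - z)" by (rule der)
    moreover have "e * norm (w - z) \<le> e * (t * M)" using wz e by simp
    ultimately have "0 \<le> (w - z) \<bullet> g + e * (t * M)" using fmin[OF w(1)] by linarith
    moreover have "(w - z) \<bullet> g = g \<bullet> (w - p) + t * ((z' - z) \<bullet> g)"
      unfolding split by (simp add: inner_add_left inner_commute[of g])
    moreover have "g \<bullet> (w - p) \<le> d * (c * t)"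
      using inner_le_dual_norm[OF N le, of g "w - p"] mult_left_mono[OF less_imp_le[OF w(2)] d]
      by (simp add: d_def)
    ultimately have "0 \<le> t * (d * c + (z' - z) \<bullet> g + e * M)"
      by (simp add: algebra_simps)
    then have "0 \<le> d * c + (z' - z) \<bullet> g + e * M"
      using t by (simp add: zero_le_mult_iff)
    then show ?thesis by (simp add: M_def algebra_simps)
  qed
  \<comment> \<open>One parameter drives both slacks to zero, with
    \<open>c = k * n + e\<close>.\<close>
  let ?F = "\<lambda>e::real. - ((k * n + e) * d) - e * (norm (z' - z) + (k * n + e))"
  have "(?F \<longlongrightarrow> ?F 0) (at_right 0)" by (intro tendsto_intros)
  moreover have "\<forall>\<^sub>F e in at_right 0. ?F e \<le> (z' - z) \<bullet> g"
    using eventually_at_right_less[of "0::real"] by eventually_elim (rule lower, auto)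
  ultimately have "?F 0 \<le> (z' - z) \<bullet> g"
    by (rule tendsto_upperbound) (simp add: trivial_limit_at_right_real)
  then show ?thesis by (simp add: n_def d_def norm_minus_commute mult_ac)
qed simp

text \<open>The sum of the variational inequalities at \<open>z1\<close> towards \<open>z2\<close>
  and at \<open>z2\<close> towards \<open>z1\<close>. The functions may differ, since only the set
  \<open>Z\<close> is shared. \<open>S\<close> stands for the possibly infinite supremum in the
  initialization condition.\<close>

lemma minimizers_gradient_difference:
  fixes f1 f2 :: "'a::euclidean_space \<Rightarrow> real"
  assumes N: "is_norm N" and le: "\<forall>v. norm v \<le> N v"
    and min1: "is_arg_min f1 (\<lambda>u. u \<in> Z) z1" and g1: "GDERIV f1 z1 :> g1"
    and min2: "is_arg_min f2 (\<lambda>u. u \<in> Z) z2" and g2: "GDERIV f2 z2 :> g2"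
    and S: "ennreal (dual_norm N g2) \<le> S"
    and init: "2 * concavity N Z * (ennreal (dual_norm N g1) + S) \<le> ennreal r" and r: "0 \<le> r"
  shows "(z2 - z1) \<bullet> (g2 - g1) \<le> r / 2 * (norm (z2 - z1))\<^sup>2"
proof -
  let ?d1 = "dual_norm N g1" and ?d2 = "dual_norm N g2"
  have d: "0 \<le> ?d1" "0 \<le> ?d2" by (rule dual_norm_nonneg[OF N le])+
  have "2 * concavity N Z * ennreal (?d1 + ?d2) \<le> 2 * concavity N Z * (ennreal ?d1 + S)"
    using S d by (intro mult_left_mono) (auto simp: ennreal_plus intro: add_left_mono)
  then have *: "2 * concavity N Z * ennreal (?d1 + ?d2) \<le> ennreal r"
    using init by (rule order_trans)
  show ?thesis
  proof (cases "concavity N Z")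
    \<comment> \<open>An infinite coefficient times a positive number cannot stay below
      \<open>r\<close>, so both gradients vanish.\<close>
    case top
    then have "?d1 + ?d2 = 0"
      using * d by (cases "?d1 + ?d2 = 0") (auto simp: ennreal_mult_top ennreal_top_mult top_unique split: if_splits)
    then have "?d1 = 0" "?d2 = 0" using d by linarith+
    then have "g1 = 0" "g2 = 0" using dual_norm_eq_0[OF N le] by blast+
    then show ?thesis using r by simp
  next
    case (real k)
    have mem: "z1 \<in> Z" "z2 \<in> Z" using min1 min2 by (auto simp: is_arg_min_def)
    have "ennreal (2 * k * (?d1 + ?d2)) = 2 * concavity N Z * ennreal (?d1 + ?d2)"
      using real d by (simp add: ennreal_mult)
    then have "2 * k * (?d1 + ?d2) \<le> r" using * r by (metis ennreal_le_iff)
    then have "k * (?d1 + ?d2) * (norm (z2 - z1))\<^sup>2 \<le> r / 2 * (norm (z2 - z1))\<^sup>2"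
      by (intro mult_right_mono) auto
    moreover have "- (k * ?d1 * (norm (z2 - z1))\<^sup>2) \<le> (z2 - z1) \<bullet> g1"
      using minimizer_variational_inequality[OF N le min1 mem(2) g1 real(2,1)] .
    moreover have "- (k * ?d2 * (norm (z1 - z2))\<^sup>2) \<le> (z1 - z2) \<bullet> g2"
      using minimizer_variational_inequality[OF N le min2 mem(1) g2 real(2,1)] .
    moreover have "norm (z1 - z2) = norm (z2 - z1)" by (rule norm_minus_commute)
    ultimately show ?thesis by (simp add: algebra_simps)
  qed
qed

section \<open>Gradients and partial gradients\<close>

text \<open>\<open>gradient\<close> is a definite description, so a witness is needed: the Riesz
  vector of the derivative in the standard basis.\<close>

lemma GDERIV_gradient:
  fixes f :: "'a::euclidean_space \<Rightarrow> real"
  assumes "f differentiable (at z)"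
  shows "GDERIV f z :> gradient f z"
proof -
  obtain D where D: "(f has_derivative D) (at z)" using assms by (auto simp: differentiable_def)
  then interpret D: linear D by (rule has_derivative_linear)
  have "D h = h \<bullet> (\<Sum>b\<in>Basis. D b *\<^sub>R b)" for h
  proof -
    have "D h = D (\<Sum>b\<in>Basis. (h \<bullet> b) *\<^sub>R b)" by (simp add: euclidean_representation)
    also have "\<dots> = h \<bullet> (\<Sum>b\<in>Basis. D b *\<^sub>R b)"
      by (simp add: D.sum D.scaleR inner_sum_right mult.commute)
    finally show ?thesis .
  qed
  then have "D = (\<lambda>h. h \<bullet> (\<Sum>b\<in>Basis. D b *\<^sub>R b))" by blast
  then have "GDERIV f z :> (\<Sum>b\<in>Basis. D b *\<^sub>R b)" using D by (simp add: gderiv_def)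
  then show ?thesis using gradient_eqI by metis
qed

lemma partial_gradients:
  fixes L :: "'a::euclidean_space \<times> 'b::euclidean_space \<Rightarrow> real"
  assumes "L differentiable (at (u, v))"
  shows "GDERIV (\<lambda>a. L (a, v)) u :> grad_x L u v"
    and "GDERIV (\<lambda>b. L (u, b)) v :> grad_y L u v"
    and "gradient L (u, v) = (grad_x L u v, grad_y L u v)"
proof -
  have L: "(L has_derivative (\<lambda>h. h \<bullet> gradient L (u, v))) (at (u, v))"
    using GDERIV_gradient[OF assms] by (simp add: gderiv_def)
  have "((\<lambda>a. (a, v)) has_derivative (\<lambda>h. (h, 0))) (at u)"
    by (auto intro!: derivative_eq_intros)
  from diff_chain_at[OF this L]
  have x: "GDERIV (\<lambda>a. L (a, v)) u :> fst (gradient L (u, v))"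
    by (simp add: gderiv_def o_def inner_prod_def)
  have "((\<lambda>b. (u, b)) has_derivative (\<lambda>h. (0, h))) (at v)"
    by (auto intro!: derivative_eq_intros)
  from diff_chain_at[OF this L]
  have y: "GDERIV (\<lambda>b. L (u, b)) v :> snd (gradient L (u, v))"
    by (simp add: gderiv_def o_def inner_prod_def)
  have "grad_x L u v = fst (gradient L (u, v))" "grad_y L u v = snd (gradient L (u, v))"
    unfolding grad_x_def grad_y_def using gradient_eqI[OF x] gradient_eqI[OF y] by blast+
  then show "GDERIV (\<lambda>a. L (a, v)) u :> grad_x L u v" "GDERIV (\<lambda>b. L (u, b)) v :> grad_y L u v"
    "gradient L (u, v) = (grad_x L u v, grad_y L u v)"
    using x y by auto
qed

section \<open>The scalar contraction inequality\<close>

text \<open>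
  Here \<open>a\<close> and \<open>b\<close> are the squared distances of the minimized and of the fixed block, \<open>A\<close> and \<open>B\<close>
  the divergences of these blocks, and \<open>P\<close> and \<open>Q\<close> the two cross terms.
\<close>

lemma divergence_contraction:
  fixes A B P Q a b \<alpha> \<alpha>' \<beta>' \<mu> \<mu>' :: real
  assumes opt: "A + P \<le> (\<alpha> - \<mu>) / 2 * a"
    and rsc: "\<alpha> * a + \<alpha>' * b - (\<alpha> * \<epsilon>\<^sup>2 + \<alpha>' * \<epsilon>'\<^sup>2) \<le> A + P + (B + Q)"
    and cross: "\<bar>P - Q\<bar> \<le> 1/2 * \<mu> * a + 1/2 * \<mu>' * b + (\<alpha> * \<epsilon>\<^sup>2 + \<alpha>' * \<epsilon>'\<^sup>2)"
    and smooth: "B \<le> \<beta>' * b + \<alpha>' * \<epsilon>'\<^sup>2"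
    and nonneg: "0 \<le> a" "0 \<le> b" "0 \<le> \<mu>" "\<mu>' \<le> \<alpha>'" "0 < \<alpha>" "0 < \<alpha>'" "\<alpha>' \<le> \<beta>'"
  shows "sqrt (max 0 A) + sqrt \<alpha> * \<epsilon>
    \<le> sqrt (1 - \<alpha>' / (2 * \<beta>')) * sqrt (max 0 B) + sqrt (8 * (\<alpha> * \<epsilon>\<^sup>2 + \<alpha>' * \<epsilon>'\<^sup>2))"
proof -
  define E where "E = \<alpha> * \<epsilon>\<^sup>2 + \<alpha>' * \<epsilon>'\<^sup>2"
  define q where "q = \<alpha>' / (2 * \<beta>')"
  have E': "0 \<le> \<alpha>' * \<epsilon>'\<^sup>2" "\<alpha> * \<epsilon>\<^sup>2 \<le> E" "\<alpha>' * \<epsilon>'\<^sup>2 \<le> E" and E: "0 \<le> E"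
    using nonneg by (auto simp: E_def)
  have q: "0 \<le> q" "q \<le> 1/2" using nonneg by (auto simp: q_def field_simps)
  \<comment> \<open>The choice of \<open>q\<close> turns \<open>\<beta>' * b\<close> into half of
    \<open>\<alpha>' * b\<close>, which is what strong convexity leaves over after
    \<open>\<mu>' \<le> \<alpha>'\<close> has been used.\<close>
  have "q * (B - \<alpha>' * \<epsilon>'\<^sup>2) \<le> q * (\<beta>' * b)"
    using smooth q by (intro mult_left_mono) auto
  also have "\<dots> = 1/2 * \<alpha>' * b" using nonneg by (simp add: q_def field_simps)
  finally have "q * B \<le> 1/2 * \<alpha>' * b + q * (\<alpha>' * \<epsilon>'\<^sup>2)" by (simp add: algebra_simps)
  moreover have "q * (\<alpha>' * \<epsilon>'\<^sup>2) \<le> 1/2 * E" using q E E' by (intro mult_mono) auto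
  moreover have "0 \<le> \<mu> * a" "\<mu>' * b \<le> \<alpha>' * b" using nonneg by (auto intro: mult_right_mono)
  moreover have "Q - P \<le> 1/2 * (\<mu> * a) + 1/2 * (\<mu>' * b) + E" using cross by (simp add: E_def)
  moreover have "A + P \<le> 1/2 * (\<alpha> * a) - 1/2 * (\<mu> * a)" using opt by (simp add: field_simps)
  moreover have "\<alpha> * a + \<alpha>' * b - E \<le> A + P + (B + Q)" using rsc by (simp add: E_def)
  \<comment> \<open>After \<open>Q\<close> is replaced by \<open>P\<close>, the right side of strong
    convexity contains \<open>A + 2 * P\<close>. Writing this as \<open>2 * (A + P) - A\<close> and
    using optimality twice cancels \<open>\<alpha> * a\<close>. The errors are \<open>E\<close> from
    strong convexity, \<open>E\<close> from the cross terms and \<open>E / 2\<close> from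
    smoothness.\<close>
  ultimately have "A \<le> B - q * B + 5/2 * E" by linarith
  moreover have "(1 - q) * B \<le> (1 - q) * max 0 B" using q by (intro mult_left_mono) auto
  moreover have "0 \<le> (1 - q) * max 0 B" using q by simp
  ultimately have "max 0 A \<le> (1 - q) * max 0 B + 5/2 * E"
    using E by (simp add: algebra_simps)
  then have "sqrt (max 0 A) \<le> sqrt ((1 - q) * max 0 B + 5/2 * E)" by (rule real_sqrt_le_mono)
  also have "\<dots> \<le> sqrt ((1 - q) * max 0 B) + sqrt (5/2 * E)"
    using q E by (intro sqrt_add_le_add_sqrt) auto
  finally have "sqrt (max 0 A) \<le> sqrt (1 - q) * sqrt (max 0 B) + sqrt (5/2) * sqrt E"
    by (simp only: real_sqrt_mult)
  \<comment> \<open>This term is the additive loss of the relaxed triangle inequality, absorbed here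
    in advance.\<close>
  moreover have "sqrt \<alpha> * \<epsilon> \<le> sqrt E"
    using E'(2) nonneg by (intro real_le_rsqrt) (simp add: power_mult_distrib)
  \<comment> \<open>The rational number \<open>14/5 = 9/5 + 1\<close> separates the two
    sides.\<close>
  moreover have "(sqrt (5/2) + 1) * sqrt E \<le> sqrt 8 * sqrt E"
  proof (intro mult_right_mono)
    have "sqrt (5/2) \<le> 9/5" by (intro real_le_lsqrt) (auto simp: power2_eq_square)
    moreover have "14/5 \<le> sqrt 8" by (intro real_le_rsqrt) (auto simp: power2_eq_square)
    ultimately show "sqrt (5/2) + 1 \<le> sqrt 8" by linarith
  qed (use E in simp)
  ultimately show ?thesis
    unfolding E_def[symmetric] q_def[symmetric] by (simp add: real_sqrt_mult algebra_simps)
qed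

section \<open>The two half-steps of alternating minimization\<close>

theorem theorem2:
  fixes L :: "(real ^ 'm) \<times> (real ^ 'n) \<Rightarrow> real"
    and Nx :: "real ^ 'm \<Rightarrow> real" and Ny :: "real ^ 'n \<Rightarrow> real"
    and X X0 :: "(real ^ 'm) set" and Y Y0 :: "(real ^ 'n) set"
    and x :: "nat \<Rightarrow> real ^ 'm" and y :: "nat \<Rightarrow> real ^ 'n"
    and xh :: "real ^ 'm" and yh :: "real ^ 'n"
    and xmin :: "real ^ 'n \<Rightarrow> real ^ 'm" and ymin :: "real ^ 'm \<Rightarrow> real ^ 'n"
    and \<rho>x \<rho>y \<alpha>x \<alpha>y \<beta>x \<beta>y \<mu>x \<mu>y \<epsilon>x \<epsilon>y :: real
    and \<delta>x \<delta>y :: "nat \<Rightarrow> real"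
  assumes "is_norm Nx" and "\<forall>v. Nx v \<ge> norm v"
    and "is_norm Ny" and "\<forall>v. Ny v \<ge> norm v"
    and "L differentiable_on UNIV"
    and "closed X" and "closed Y"
    and "x 0 \<in> X" and "y 0 \<in> Y"
    and "\<rho>x > 0" and "\<rho>y > 0"
    and "X0 = X \<inter> cball (x 0) \<rho>x" and "Y0 = Y \<inter> cball (y 0) \<rho>y"
    and "is_arg_min L (\<lambda>z. z \<in> X0 \<times> Y0) (xh, yh)"
    and "\<forall>v\<in>Y0. is_arg_min (\<lambda>u. L (u, v)) (\<lambda>u. u \<in> X0) (xmin v)"
    and "\<forall>u\<in>X0. is_arg_min (\<lambda>v. L (u, v)) (\<lambda>v. v \<in> Y0) (ymin u)"
    and "0 < \<alpha>x" and "\<alpha>x \<le> \<beta>x" and "0 < \<alpha>y" and "\<alpha>y \<le> \<beta>y"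
    and "0 \<le> \<mu>x" and "\<mu>x \<le> \<alpha>x" and "0 \<le> \<mu>y" and "\<mu>y \<le> \<alpha>y"
    and "0 \<le> \<epsilon>x" and "0 \<le> \<epsilon>y"
    and "joint_RSC L X0 Y0 xh yh \<alpha>x \<alpha>y \<epsilon>x \<epsilon>y"
    and "restricted_smoothness L X0 Y0 xh yh \<alpha>x \<alpha>y \<beta>x \<beta>y \<epsilon>x \<epsilon>y"
    and "cross_product_bound L X0 Y0 xh yh \<alpha>x \<alpha>y \<mu>x \<mu>y \<epsilon>x \<epsilon>y"
    and "initialization_condition L Nx Ny X0 Y0 xh yh xmin ymin \<alpha>x \<alpha>y \<mu>x \<mu>y"
    and "relaxed_triangle L X0 Y0 xh yh \<alpha>x \<alpha>y \<beta>x \<beta>y \<epsilon>x \<epsilon>y"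
    and "\<forall>t\<ge>1. \<delta>x t \<ge> 0 \<and> \<delta>y t \<ge> 0"
    and "\<forall>t\<ge>1. x t \<in> X0 \<inter> cball (xmin (y (t - 1))) (\<delta>x t)"
    and "\<forall>t\<ge>1. y t \<in> Y0 \<inter> cball (ymin (x t)) (\<delta>y t)"
  shows "\<forall>t\<ge>1.
    div_x L xh yh (x t)
      \<le> sqrt (1 - \<alpha>y / (2 * \<beta>y)) * div_y L xh yh (y (t - 1))
        + sqrt \<beta>x * \<delta>x t + sqrt (8 * (\<alpha>x * \<epsilon>x\<^sup>2 + \<alpha>y * \<epsilon>y\<^sup>2)) \<and>
    div_y L xh yh (y t)
      \<le> sqrt (1 - \<alpha>x / (2 * \<beta>x)) * div_x L xh yh (x t)
        + sqrt \<beta>y * \<delta>y t + sqrt (8 * (\<alpha>x * \<epsilon>x\<^sup>2 + \<alpha>y * \<epsilon>y\<^sup>2))"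
proof -
  note N = assms(1-4) and diffL = assms(5) and sets = assms(6-13)
    and argmin = assms(14) and xmin = assms(15) and ymin = assms(16)
    and par = assms(17-26) and rsc = assms(27) and smooth = assms(28) and cross = assms(29)
    and init = assms(30) and tri = assms(31) and xit = assms(33) and yit = assms(34)
  let ?E = "\<alpha>x * \<epsilon>x\<^sup>2 + \<alpha>y * \<epsilon>y\<^sup>2"
  have diff: "L differentiable (at (u, v))" for u v
    using diffL by (simp add: differentiable_on_def)
  note pg = partial_gradients[OF diff]
  have xh: "xh \<in> X0" and yh: "yh \<in> Y0" using argmin by (auto simp: is_arg_min_def)
  have minx: "is_arg_min (\<lambda>u. L (u, yh)) (\<lambda>u. u \<in> X0) xh"
    and miny: "is_arg_min (\<lambda>v. L (xh, v)) (\<lambda>v. v \<in> Y0) yh"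
    using argmin by (auto simp: is_arg_min_def)
  have inx: "xmin v \<in> X0" if "v \<in> Y0" for v using xmin that by (auto simp: is_arg_min_def)
  have iny: "ymin u \<in> Y0" if "u \<in> X0" for u using ymin that by (auto simp: is_arg_min_def)
  have rsc': "\<alpha>x * (norm (u - xh))\<^sup>2 + \<alpha>y * (norm (v - yh))\<^sup>2 - ?E
      \<le> (u - xh) \<bullet> (grad_x L u v - grad_x L xh yh) + (v - yh) \<bullet> (grad_y L u v - grad_y L xh yh)"
    if "u \<in> X0" "v \<in> Y0" for u v
    using rsc that by (auto simp: joint_RSC_def pg(3) inner_prod_def algebra_simps)
  have stepx: "div_x L xh yh (xmin v) + sqrt \<alpha>x * \<epsilon>x
      \<le> sqrt (1 - \<alpha>y / (2 * \<beta>y)) * div_y L xh yh v + sqrt (8 * ?E)" if v: "v \<in> Y0" for v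
    unfolding div_x_def div_y_def
  proof (rule divergence_contraction)
    let ?u = "xmin v"
    \<comment> \<open>The full gradient differences telescope through \<open>(?u, yh)\<close> for
      the first block and \<open>(xh, v)\<close> for the second. Each splits into a divergence and a
      cross term.\<close>
    let ?P = "(?u - xh) \<bullet> (grad_x L ?u v - grad_x L ?u yh)"
    let ?Q = "(v - yh) \<bullet> (grad_y L ?u v - grad_y L xh v)"
    have u: "?u \<in> X0" using inx v by blast
    \<comment> \<open>Here \<open>xh\<close> minimizes \<open>L\<close> at the fixed
      \<open>yh\<close> and \<open>?u\<close> minimizes it at the fixed \<open>v\<close>, both over
      \<open>X0\<close>.\<close>
    have "(?u - xh) \<bullet> (grad_x L ?u v - grad_x L xh yh) \<le> (\<alpha>x - \<mu>x) / 2 * (norm (?u - xh))\<^sup>2"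
    proof (rule minimizers_gradient_difference[OF N(1,2) minx pg(1) _ pg(1)])
      show "ennreal (dual_norm Nx (grad_x L ?u v))
          \<le> (SUP y\<in>Y0. ennreal (dual_norm Nx (grad_x L (xmin y) y)))"
        using v by (intro SUP_upper)
    qed (use xmin v init par in \<open>auto simp: initialization_condition_def\<close>)
    then show "div2_x L xh yh ?u + ?P \<le> (\<alpha>x - \<mu>x) / 2 * (norm (?u - xh))\<^sup>2"
      by (simp add: div2_x_def inner_diff_right)
    show "\<alpha>x * (norm (?u - xh))\<^sup>2 + \<alpha>y * (norm (v - yh))\<^sup>2 - ?E
        \<le> div2_x L xh yh ?u + ?P + (div2_y L xh yh v + ?Q)"
      using rsc'[OF u v] by (simp add: div2_x_def div2_y_def inner_diff_right)
    show "\<bar>?P - ?Q\<bar> \<le> 1/2 * \<mu>x * (norm (?u - xh))\<^sup>2 + 1/2 * \<mu>y * (norm (v - yh))\<^sup>2 + ?E"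
      using cross u v unfolding cross_product_bound_def by (simp add: add.assoc)
    show "div2_y L xh yh v \<le> \<beta>y * (norm (v - yh))\<^sup>2 + \<alpha>y * \<epsilon>y\<^sup>2"
      using smooth xh v by (auto simp: restricted_smoothness_def)
  qed (use par in auto)
  \<comment> \<open>The blocks exchange roles, and the error sum is written in the order in which
    the scalar lemma yields it.\<close>
  have stepy: "div_y L xh yh (ymin u) + sqrt \<alpha>y * \<epsilon>y
      \<le> sqrt (1 - \<alpha>x / (2 * \<beta>x)) * div_x L xh yh u + sqrt (8 * (\<alpha>y * \<epsilon>y\<^sup>2 + \<alpha>x * \<epsilon>x\<^sup>2))"
    if u: "u \<in> X0" for u
    unfolding div_x_def div_y_def
  proof (rule divergence_contraction)
    let ?v = "ymin u"
    let ?P = "(?v - yh) \<bullet> (grad_y L u ?v - grad_y L xh ?v)"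
    let ?Q = "(u - xh) \<bullet> (grad_x L u ?v - grad_x L u yh)"
    have v: "?v \<in> Y0" using iny u by blast
    have "(?v - yh) \<bullet> (grad_y L u ?v - grad_y L xh yh) \<le> (\<alpha>y - \<mu>y) / 2 * (norm (?v - yh))\<^sup>2"
    proof (rule minimizers_gradient_difference[OF N(3,4) miny pg(2) _ pg(2)])
      show "ennreal (dual_norm Ny (grad_y L u ?v))
          \<le> (SUP x\<in>X0. ennreal (dual_norm Ny (grad_y L x (ymin x))))"
        using u by (intro SUP_upper)
    qed (use ymin u init par in \<open>auto simp: initialization_condition_def\<close>)
    then show "div2_y L xh yh ?v + ?P \<le> (\<alpha>y - \<mu>y) / 2 * (norm (?v - yh))\<^sup>2"
      by (simp add: div2_y_def inner_diff_right)
    show "\<alpha>y * (norm (?v - yh))\<^sup>2 + \<alpha>x * (norm (u - xh))\<^sup>2 - (\<alpha>y * \<epsilon>y\<^sup>2 + \<alpha>x * \<epsilon>x\<^sup>2)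
        \<le> div2_y L xh yh ?v + ?P + (div2_x L xh yh u + ?Q)"
      using rsc'[OF u v] by (simp add: div2_x_def div2_y_def inner_diff_right)
    have "\<bar>?Q - ?P\<bar> \<le> 1/2 * \<mu>x * (norm (u - xh))\<^sup>2 + 1/2 * \<mu>y * (norm (?v - yh))\<^sup>2
        + \<alpha>x * \<epsilon>x\<^sup>2 + \<alpha>y * \<epsilon>y\<^sup>2"
      using cross u v unfolding cross_product_bound_def by blast
    then show "\<bar>?P - ?Q\<bar> \<le> 1/2 * \<mu>y * (norm (?v - yh))\<^sup>2 + 1/2 * \<mu>x * (norm (u - xh))\<^sup>2
        + (\<alpha>y * \<epsilon>y\<^sup>2 + \<alpha>x * \<epsilon>x\<^sup>2)"
      by (simp only: abs_minus_commute[of ?P ?Q])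
    show "div2_x L xh yh u \<le> \<beta>x * (norm (u - xh))\<^sup>2 + \<alpha>x * \<epsilon>x\<^sup>2"
      using smooth yh u by (auto simp: restricted_smoothness_def)
  qed (use par in auto)
  show ?thesis
  proof (intro allI impI conjI)
    fix t :: nat assume t: "1 \<le> t"
    have xt: "x t \<in> X0" and dx: "norm (x t - xmin (y (t - 1))) \<le> \<delta>x t"
      using xit t by (auto simp: dist_norm norm_minus_commute)
    have yt: "y t \<in> Y0" and dy: "norm (y t - ymin (x t)) \<le> \<delta>y t"
      using yit t by (auto simp: dist_norm norm_minus_commute)
    \<comment> \<open>For \<open>t = 1\<close> this is the starting point, the center of the ball
      defining \<open>Y0\<close>.\<close>
    have yp: "y (t - 1) \<in> Y0"
      using yit sets t by (cases "t = 1") auto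
    have "div_x L xh yh (x t) \<le> div_x L xh yh (xmin (y (t - 1)))
        + sqrt \<beta>x * norm (x t - xmin (y (t - 1))) + sqrt \<alpha>x * \<epsilon>x"
      using tri xt inx[OF yp] by (auto simp: relaxed_triangle_def)
    moreover have "sqrt \<beta>x * norm (x t - xmin (y (t - 1))) \<le> sqrt \<beta>x * \<delta>x t"
      using dx par by (intro mult_left_mono) auto
    ultimately show "div_x L xh yh (x t)
      \<le> sqrt (1 - \<alpha>y / (2 * \<beta>y)) * div_y L xh yh (y (t - 1)) + sqrt \<beta>x * \<delta>x t + sqrt (8 * ?E)"
      using stepx[OF yp] by linarith
    have "div_y L xh yh (y t) \<le> div_y L xh yh (ymin (x t))
        + sqrt \<beta>y * norm (y t - ymin (x t)) + sqrt \<alpha>y * \<epsilon>y"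
      using tri yt iny[OF xt] by (auto simp: relaxed_triangle_def)
    moreover have "sqrt \<beta>y * norm (y t - ymin (x t)) \<le> sqrt \<beta>y * \<delta>y t"
      using dy par by (intro mult_left_mono) auto
    ultimately show "div_y L xh yh (y t)
      \<le> sqrt (1 - \<alpha>x / (2 * \<beta>x)) * div_x L xh yh (x t) + sqrt \<beta>y * \<delta>y t + sqrt (8 * ?E)"
      using stepy[OF xt] by (simp add: add.commute[of "\<alpha>y * \<epsilon>y\<^sup>2"])
  qed
qed

end
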